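(* Let $(P,\leq,0,1)$ be a bounded relatively pseudocomplemented poset with relative pseudocomplement operation $*$, and for $x\in P$ let $x^*:=x*0$. Define $M(x,y):=L(x,y)$ and $R(x,y):=L(x*y)$ for all $x,y\in P$. Then $(P,\leq,{}^*,M,R,0,1)$ is an operator residuated poset satisfying divisibility, i.e. $M(R(x,y),x)=L(x,y)$ for all $x,y\in P$.
   Context: For a poset $(P,\leq)$ and $A\subseteq P$ let $L(A)=\{x\in P\mid x\leq y\text{ for all }y\in A\}$ and $U(A)=\{x\in P\mid y\leq x\text{ for all }y\in A\}$; we write $L(a)$ for $L(\{a\})$, $L(a,b)$ for $L(\{a,b\})$, etc. A poset is relatively pseudocomplemented if for all $a,b\in P$ there is a greatest element $c\in P$ with $L(a,c)\subseteq L(b)$; this $c$ is denoted $a*b$. An operator left residuated poset is a system $(P,\leq,{}',M,R,0,1)$ where $(P,\leq,0,1)$ is a bounded poset, $'$ is a unary operation on $P$, and $M,R$ are maps $P^2\to 2^P$ such that for all $x,y,z\in P$: (1) $M(x,1)=M(1,x)=L(x)$; (2) $R(x,y)=P$ iff $x\leq y$; (3) $M(x,y)\subseteq L(z)$ iff $L(x)\subseteq R(y,z)$; (4) $R(x,0)=L(x')$. It is called an operator residuated poset if moreover $M(x,y)=M(y,x)$ for all $x,y$. For $A,B\subseteq P$, $M(A,B):=\bigcup_{(x,y)\in A\times B}M(x,y)$ and $R(A,B):=\bigcup_{(x,y)\in A\times B}R(x,y)$ (elements identified with singletons); divisibility is the identity $M(R(x,y),x)=L(x,y)$. *)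

theory Defs
  imports Main
begin

text \<open>
  A poset is a type of class \<^class>\<open>order\<close>, and its underlying set is \<^term>\<open>UNIV\<close>. A bounded poset is a
  type of sort \<open>{order_bot, order_top}\<close>, where \<^term>\<open>bot\<close> and \<^term>\<open>top\<close> are the elements
  0 and 1.
\<close>

definition lower_cone :: "'a::order set \<Rightarrow> 'a set" where
  "lower_cone A = {x. \<forall>y\<in>A. x \<le> y}"

definition relatively_pseudocomplemented :: "'a::order itself \<Rightarrow> bool" where
  "relatively_pseudocomplemented (_ :: 'a itself) \<longleftrightarrow>
     (\<forall>a b :: 'a. \<exists>c. lower_cone {a, c} \<subseteq> lower_cone {b} \<and>
        (\<forall>d. lower_cone {a, d} \<subseteq> lower_cone {b} \<longrightarrow> d \<le> c))"

text \<open>The element \<open>a * b\<close>; unspecified when the greatest element does not exist.\<close>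

definition rel_pc :: "'a::order \<Rightarrow> 'a \<Rightarrow> 'a" where
  "rel_pc a b = (GREATEST c. lower_cone {a, c} \<subseteq> lower_cone {b})"

locale operator_left_residuated_poset =
  fixes compl :: "'a::{order_bot, order_top} \<Rightarrow> 'a"
    and M :: "'a \<Rightarrow> 'a \<Rightarrow> 'a set"
    and R :: "'a \<Rightarrow> 'a \<Rightarrow> 'a set"
  assumes M_top_right: "M x top = lower_cone {x}"
    and M_top_left: "M top x = lower_cone {x}"
    and R_eq_UNIV_iff: "R x y = UNIV \<longleftrightarrow> x \<le> y"
    and residuation: "M x y \<subseteq> lower_cone {z} \<longleftrightarrow> lower_cone {x} \<subseteq> R y z"
    and R_bot: "R x bot = lower_cone {compl x}"

locale operator_residuated_poset = operator_left_residuated_poset +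
  assumes M_commute: "M x y = M y x"

text \<open>Extension of an operator from elements to subsets.\<close>

definition lift_op :: "('a \<Rightarrow> 'a \<Rightarrow> 'a set) \<Rightarrow> 'a set \<Rightarrow> 'a set \<Rightarrow> 'a set" where
  "lift_op F A B = (\<Union>(x, y) \<in> A \<times> B. F x y)"

definition divisibility ::
  "('a::order \<Rightarrow> 'a \<Rightarrow> 'a set) \<Rightarrow> ('a \<Rightarrow> 'a \<Rightarrow> 'a set) \<Rightarrow> bool" where
  "divisibility M R \<longleftrightarrow> (\<forall>x y. lift_op M (R x y) {x} = lower_cone {x, y})"

end

theory Submission
  imports Defs
begin

text \<open>
  Everything follows from the adjunction \<open>d \<le> a * b \<longleftrightarrow> L(a, d) \<subseteq> L(b)\<close>. For divisibility,
  every \<open>u\<close> in \<open>L(x, y)\<close> lies below \<open>x * y\<close>, because \<open>L(x, u) \<subseteq> L(y)\<close>.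
\<close>

text \<open>By hypothesis the greatest element exists, so \<open>GREATEST\<close> really denotes it.
  The admissible \<open>d\<close> form a down-set because L(a, d) grows with \<open>d\<close>, hence
  they are exactly the elements below it.\<close>

lemma le_rel_pc_iff:
  fixes a b d :: "'a::order"
  assumes "relatively_pseudocomplemented TYPE('a)"
  shows "d \<le> rel_pc a b \<longleftrightarrow> lower_cone {a, d} \<subseteq> lower_cone {b}"
proof -
  obtain c where c: "lower_cone {a, c} \<subseteq> lower_cone {b}"
      "\<And>d. lower_cone {a, d} \<subseteq> lower_cone {b} \<Longrightarrow> d \<le> c"
    using assms unfolding relatively_pseudocomplemented_def by blast
  have "rel_pc a b = c"
    unfolding rel_pc_def using c by (rule Greatest_equality)
  moreover have "lower_cone {a, d} \<subseteq> lower_cone {a, c}" if "d \<le> c"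
    using that by (auto simp: lower_cone_def intro: order_trans)
  ultimately show ?thesis
    using c by blast
qed

lemma lower_cone_singleton_subset_iff:
  "lower_cone {x} \<subseteq> lower_cone {y} \<longleftrightarrow> x \<le> y"
  by (auto simp: lower_cone_def intro: order_trans)

theorem theorem1:
  fixes compl :: "'a::{order_bot, order_top} \<Rightarrow> 'a"
    and M R :: "'a \<Rightarrow> 'a \<Rightarrow> 'a set"
  assumes "relatively_pseudocomplemented TYPE('a)"
    and "\<And>x. compl x = rel_pc x bot"
    and "\<And>x y. M x y = lower_cone {x, y}"
    and "\<And>x y. R x y = lower_cone {rel_pc x y}"
  shows "operator_residuated_poset compl M R \<and> divisibility M R"
proof
  note adj = le_rel_pc_iff[OF assms(1)]
  show "operator_residuated_poset compl M R"
  proof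
    fix x y z :: 'a
    show "M x top = lower_cone {x}" "M top x = lower_cone {x}"
      by (auto simp: assms(3) lower_cone_def)
    \<comment> \<open>A principal down-set is all of P iff it contains \<open>top\<close>. The
      adjunction at \<open>d = top\<close> then applies, where L(x, top) = L(x).\<close>
    have "R x y = UNIV \<longleftrightarrow> top \<le> rel_pc x y"
      by (auto simp: assms(4) lower_cone_def intro: order_trans[OF top_greatest])
    also have "\<dots> \<longleftrightarrow> lower_cone {x} \<subseteq> lower_cone {y}"
      unfolding adj by (simp add: lower_cone_def)
    finally show "R x y = UNIV \<longleftrightarrow> x \<le> y"
      by (simp only: lower_cone_singleton_subset_iff)
    \<comment> \<open>Since \<open>R y z\<close> is the cone of y * z, the right side says that
      \<open>x\<close> is below y * z, which by adjunction is L(y, x) \<subseteq> L(z).\<close>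
    show "M x y \<subseteq> lower_cone {z} \<longleftrightarrow> lower_cone {x} \<subseteq> R y z"
      by (simp add: assms(3,4) lower_cone_singleton_subset_iff adj insert_commute)
    show "R x bot = lower_cone {compl x}"
      by (simp add: assms(2,4))
    show "M x y = M y x"
      by (simp add: assms(3) insert_commute)
  qed
  have "lift_op M (R x y) {x} = lower_cone {x, y}" for x y
  proof
    \<comment> \<open>Modus ponens: \<open>u\<close> belongs to L(x, v), which the adjunction puts
      inside L(y).\<close>
    have "u \<le> y" if "v \<le> rel_pc x y" "u \<le> v" "u \<le> x" for u v
      using that unfolding adj by (auto simp: lower_cone_def)
    then show "lift_op M (R x y) {x} \<subseteq> lower_cone {x, y}"
      by (auto simp: lift_op_def assms(3,4) lower_cone_def)
  next
    \<comment> \<open>Once \<open>u\<close> is below x * y, it can itself serve as the index in the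
      union, as \<open>u\<close> lies in \<open>M u x\<close> when it is below
      \<open>x\<close>.\<close>
    have "u \<le> rel_pc x y" if "u \<le> y" for u
      unfolding adj using that by (auto simp: lower_cone_def intro: order_trans)
    then show "lower_cone {x, y} \<subseteq> lift_op M (R x y) {x}"
      by (auto simp: lift_op_def assms(3,4) lower_cone_def)
  qed
  then show "divisibility M R"
    by (simp add: divisibility_def)
qed

end
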